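(* Let $\Gamma$ be a directed graph on the node set $[k]$. If $\Gamma$ is acyclic then the map $\kappa$, sending a face $F$ of the braid cone $Q(\Gamma,\mathbf 0)$ to $F\cap[0,1]^k$, is a poset isomorphism from the poset of faces of $Q(\Gamma,\mathbf 0)$ to the face figure $\mathcal F_{01}$ of the face $F_{01}$ of the order polytope $\operatorname{Ord}(\Gamma)$.
   Context: The braid cone is $Q(\Gamma,\mathbf 0)=\{x\in\mathbb R^k : x_i\le x_j\text{ for all arcs }(i,j)\in\Gamma\}$; its faces are its nonempty faces (including itself), ordered by inclusion. For acyclic $\Gamma$, the order polytope is $\operatorname{Ord}(\Gamma)=Q(\Gamma,\mathbf 0)\cap[0,1]^k$, i.e. the order polytope of the partial order on $[k]$ generated by the arcs of $\Gamma$. It contains $\mathbf 0=(0,\dots,0)$ and $\mathbf 1=(1,\dots,1)$ as vertices, and $F_{01}$ denotes the unique minimal face of $\operatorname{Ord}(\Gamma)$ containing both of them. The face figure $\mathcal F_{01}$ is the principal filter of $F_{01}$ in the face poset of $\operatorname{Ord}(\Gamma)$, i.e. the set of all faces of $\operatorname{Ord}(\Gamma)$ (including $\operatorname{Ord}(\Gamma)$ itself) containing $F_{01}$, ordered by inclusion. *)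

theory Defs
  imports "HOL-Analysis.Analysis"
begin

text \<open>A directed graph on \<open>{1, \<dots>, k}\<close> is given by its set of arcs, a relation on a finite
  type \<open>'n\<close> with \<open>k\<close> elements; an arc \<open>(i, j)\<close> stands for \<open>x\<^sub>i \<le> x\<^sub>j\<close>.\<close>

definition braid_cone :: "('n::finite \<times> 'n) set \<Rightarrow> (real ^ 'n) set" where
  "braid_cone \<Gamma> = {x. \<forall>(i, j) \<in> \<Gamma>. x $ i \<le> x $ j}"

definition order_polytope :: "('n::finite \<times> 'n) set \<Rightarrow> (real ^ 'n) set" where
  "order_polytope \<Gamma> = braid_cone \<Gamma> \<inter> cbox 0 1"

text \<open>The library's \<open>face_of\<close> admits the empty face; it is excluded here.\<close>

definition faces :: "(real ^ 'n::finite) set \<Rightarrow> (real ^ 'n) set set" where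
  "faces P = {F. F face_of P \<and> F \<noteq> {}}"

definition face01 :: "('n::finite \<times> 'n) set \<Rightarrow> (real ^ 'n) set" where
  "face01 \<Gamma> = (THE F. F \<in> faces (order_polytope \<Gamma>) \<and> 0 \<in> F \<and> 1 \<in> F \<and>
     (\<forall>G \<in> faces (order_polytope \<Gamma>). 0 \<in> G \<and> 1 \<in> G \<and> G \<subseteq> F \<longrightarrow> G = F))"

definition face_figure :: "(real ^ 'n::finite) set \<Rightarrow> (real ^ 'n) set \<Rightarrow> (real ^ 'n) set set" where
  "face_figure P F = {G \<in> faces P. F \<subseteq> G}"

definition kappa :: "(real ^ 'n::finite) set \<Rightarrow> (real ^ 'n) set" where
  "kappa F = F \<inter> cbox 0 1"

definition inclusion_iso :: "('a set \<Rightarrow> 'b set) \<Rightarrow> 'a set set \<Rightarrow> 'b set set \<Rightarrow> bool" where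
  "inclusion_iso f A B \<longleftrightarrow>
     bij_betw f A B \<and> (\<forall>X \<in> A. \<forall>Y \<in> A. X \<subseteq> Y \<longleftrightarrow> f X \<subseteq> f Y)"

lemma mem_order_polytope:
  "x \<in> order_polytope \<Gamma> \<longleftrightarrow>
     (\<forall>(i, j) \<in> \<Gamma>. x $ i \<le> x $ j) \<and> (\<forall>i. 0 \<le> x $ i \<and> x $ i \<le> 1)"
  by (auto simp: order_polytope_def braid_cone_def mem_box_cart)

lemma convex_braid_cone: "convex (braid_cone \<Gamma>)"
  unfolding convex_def braid_cone_def
  by (fastforce intro!: add_mono mult_left_mono)

lemma convex_order_polytope: "convex (order_polytope \<Gamma>)"
  unfolding order_polytope_def by (intro convex_Int convex_braid_cone convex_box)

text \<open>The definite description in \<open>face01\<close> is proper:\<close>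

lemma face01_ex1:
  "\<exists>!F. F \<in> faces (order_polytope \<Gamma>) \<and> 0 \<in> F \<and> 1 \<in> F \<and>
     (\<forall>G \<in> faces (order_polytope \<Gamma>). 0 \<in> G \<and> 1 \<in> G \<and> G \<subseteq> F \<longrightarrow> G = F)"
  (is "\<exists>!F. ?P F")
proof -
  define \<G> where "\<G> = {G \<in> faces (order_polytope \<Gamma>). 0 \<in> G \<and> 1 \<in> G}"
  have "0 \<in> order_polytope \<Gamma>" "1 \<in> order_polytope \<Gamma>"
    by (auto simp: mem_order_polytope)
  then have "order_polytope \<Gamma> \<in> \<G>"
    using face_of_refl[OF convex_order_polytope] by (auto simp: \<G>_def faces_def)
  then have "\<Inter>\<G> face_of order_polytope \<Gamma>"
    by (intro face_of_Inter) (auto simp: \<G>_def faces_def)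
  then have I: "\<Inter>\<G> \<in> \<G>"
    by (auto simp: \<G>_def faces_def)
  show ?thesis
  proof (rule ex1I[of _ "\<Inter>\<G>"])
    show "?P (\<Inter>\<G>)"
      using I by (auto simp: \<G>_def)
  next
    fix F assume "?P F"
    moreover from this have "\<Inter>\<G> \<subseteq> F" by (auto simp: \<G>_def)
    ultimately show "F = \<Inter>\<G>" using I unfolding \<G>_def by blast
  qed
qed

end

theory Submission
  imports Defs
begin

text \<open>A nonempty face of the braid cone is invariant under positive dilations and under
  translations by multiples of \<open>1\<close>, so it is determined by its points near the centre
  \<open>(1/2) *\<^sub>R 1\<close> of the cube. A face \<open>G\<close> of the order polytope containing \<open>0\<close> and \<open>1\<close> contains
  this centre, and the directions in which \<open>G\<close> can be left from the centre form the face of the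
  cone that is mapped to \<open>G\<close>.\<close>

lemma braid_cone_affine:
  assumes "x \<in> braid_cone \<Gamma>" "0 \<le> t"
  shows "s *\<^sub>R 1 + t *\<^sub>R x \<in> braid_cone \<Gamma>"
  using assms by (auto simp: braid_cone_def intro!: mult_left_mono)

text \<open>Any x in F is the midpoint of s1 + rx and -s1 + (2 - r)x, which both lie in the cone
  when 0 \<le> r \<le> 2; the face property then puts the first one in F. Repeated doubling removes
  the upper bound on the factor.\<close>

lemma face_of_braid_cone_affine:
  fixes x :: "real ^ 'n::finite"
  assumes F: "F face_of braid_cone \<Gamma>" and x: "x \<in> F" and t: "0 \<le> t"
  shows "s *\<^sub>R 1 + t *\<^sub>R x \<in> F"
proof -
  have C: "y \<in> braid_cone \<Gamma>" if "y \<in> F" for y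
    using F that face_of_imp_subset by blast
  \<comment> \<open>The midpoint form of the face property also covers a = b, where the open segment
    is empty.\<close>
  have two: "a \<in> F" if "y \<in> F" "a \<in> braid_cone \<Gamma>" "b \<in> braid_cone \<Gamma>" "y = (1/2) *\<^sub>R a + (1/2) *\<^sub>R b"
    for y a b
  proof (cases "a = b")
    case True
    then show ?thesis using that by (simp flip: scaleR_left_distrib)
  next
    case False
    then have "y \<in> open_segment a b"
      using that(4) by (auto simp: in_segment intro!: exI[of _ "1/2"])
    then show ?thesis using F that by (auto simp: face_of_def)
  qed
  have dbl: "(1/2) *\<^sub>R (s *\<^sub>R 1 + r *\<^sub>R y) + (1/2) *\<^sub>R ((-s) *\<^sub>R 1 + (2 - r) *\<^sub>R y) = y"
    for r s :: real and y :: "real ^ 'n"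
    by (simp add: vec_eq_iff algebra_simps)
  have small: "s *\<^sub>R 1 + r *\<^sub>R y \<in> F" if "y \<in> F" "0 \<le> r" "r \<le> 2" for r s y
    using two[OF that(1) braid_cone_affine[OF C[OF that(1)]] braid_cone_affine[OF C[OF that(1)]] dbl[symmetric]]
      that by simp
  obtain n :: nat where n: "t \<le> 2 ^ n"
    using real_arch_pow[of 2 t] by (auto intro: less_imp_le)
  have pow: "2 ^ m *\<^sub>R x \<in> F" for m :: nat
  proof (induction m)
    case (Suc m)
    then show ?case using small[of "2 ^ m *\<^sub>R x" 2 0] by simp
  qed (use x in simp)
  \<comment> \<open>After x is replaced by its multiple by 2^n, the remaining factor t / 2^n lies in
    [0, 1], within the range of \<open>small\<close>.\<close>
  show ?thesis
    using small[OF pow[of n], of "t / 2 ^ n" s] n t by (simp add: divide_le_eq)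
qed

text \<open>The centre is interior to the cube. The bound covers every smaller step too, so that
  several directions can share one step.\<close>

lemma centre_plus_small_in_cube:
  fixes x :: "real ^ 'n::finite"
  obtains d where "0 < d" "\<And>e. 0 < e \<Longrightarrow> e \<le> d \<Longrightarrow> (1/2) *\<^sub>R 1 + e *\<^sub>R x \<in> cbox 0 1"
proof
  let ?d = "1 / (2 * (norm x + 1))"
  show "0 < ?d" by (simp add: add_nonneg_pos)
  fix e :: real assume e: "0 < e" "e \<le> ?d"
  have "\<bar>e * x $ i\<bar> \<le> 1/2" for i
  proof -
    have "\<bar>e * x $ i\<bar> \<le> ?d * (norm x + 1)"
      unfolding abs_mult using e component_le_norm_cart[of x i] by (intro mult_mono) auto
    also have "\<dots> = 1/2"
      using norm_ge_zero[of x] by (simp add: field_simps add_nonneg_eq_0_iff)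
    finally show ?thesis .
  qed
  then show "(1/2) *\<^sub>R 1 + e *\<^sub>R x \<in> cbox 0 1"
    by (auto simp: mem_box_cart abs_le_iff) (smt (verit) field_sum_of_halves)+
qed

text \<open>Faces are closed under intersection, so the minimal face containing 0 and 1 is the least
  one. From here on \<open>face01\<close> enters only through the two points 0 and 1.\<close>

lemma face_figure_face01:
  "face_figure (order_polytope \<Gamma>) (face01 \<Gamma>) = {G \<in> faces (order_polytope \<Gamma>). 0 \<in> G \<and> 1 \<in> G}"
proof -
  let ?min = "\<lambda>F. F \<in> faces (order_polytope \<Gamma>) \<and> 0 \<in> F \<and> 1 \<in> F \<and>
     (\<forall>G \<in> faces (order_polytope \<Gamma>). 0 \<in> G \<and> 1 \<in> G \<and> G \<subseteq> F \<longrightarrow> G = F)"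
  have min: "?min (face01 \<Gamma>)"
    unfolding face01_def by (rule theI'[OF face01_ex1])
  have "face01 \<Gamma> \<subseteq> G" if "G \<in> faces (order_polytope \<Gamma>)" "0 \<in> G" "1 \<in> G" for G
  proof -
    have "face01 \<Gamma> \<inter> G \<in> faces (order_polytope \<Gamma>)"
      using min that by (auto simp: faces_def intro: face_of_Int)
    then have "face01 \<Gamma> \<inter> G = face01 \<Gamma>"
      using conjunct2[OF conjunct2[OF conjunct2[OF min]]] min that by simp
    then show ?thesis by blast
  qed
  then show ?thesis
    using min by (auto simp: face_figure_def)
qed

lemma kappa_in_face_figure:
  assumes "F \<in> faces (braid_cone \<Gamma>)"
  shows "kappa F \<in> face_figure (order_polytope \<Gamma>) (face01 \<Gamma>)"
proof -
  from assms obtain x where F: "F face_of braid_cone \<Gamma>" and x: "x \<in> F"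
    by (auto simp: faces_def)
  \<comment> \<open>Dilation by 0 followed by translation shows that F contains every multiple of
    1.\<close>
  have "0 \<in> kappa F" "1 \<in> kappa F"
    using face_of_braid_cone_affine[OF F x, of 0 0] face_of_braid_cone_affine[OF F x, of 0 1]
    by (simp_all add: kappa_def mem_box_cart)
  moreover have "kappa F face_of order_polytope \<Gamma>"
    unfolding kappa_def order_polytope_def by (rule face_of_slice[OF F convex_box(1)])
  ultimately show ?thesis
    by (auto simp: face_figure_face01 faces_def)
qed

text \<open>A point of F is moved into the cube near its centre by a map that preserves F, and the
  inverse map, which preserves F', brings it back.\<close>

lemma kappa_subset_iff:
  assumes "F \<in> faces (braid_cone \<Gamma>)" "F' \<in> faces (braid_cone \<Gamma>)"
  shows "kappa F \<subseteq> kappa F' \<longleftrightarrow> F \<subseteq> F'"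
proof
  assume sub: "kappa F \<subseteq> kappa F'"
  from assms have F: "F face_of braid_cone \<Gamma>" and F': "F' face_of braid_cone \<Gamma>"
    by (auto simp: faces_def)
  show "F \<subseteq> F'"
  proof
    fix x assume x: "x \<in> F"
    obtain d where d: "0 < d" "(1/2) *\<^sub>R 1 + d *\<^sub>R x \<in> cbox 0 1"
      using centre_plus_small_in_cube[of x] by (metis order_refl)
    then have "(1/2) *\<^sub>R 1 + d *\<^sub>R x \<in> F'"
      using face_of_braid_cone_affine[OF F x, of d "1/2"] sub by (auto simp: kappa_def)
    \<comment> \<open>These coefficients invert the map sending x to (1/2)1 + dx.\<close>
    from face_of_braid_cone_affine[OF F' this, of "1/d" "- (1/(2*d))"] d(1)
    show "x \<in> F'"
      by (simp add: scaleR_right_distrib mult.commute)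
  qed
qed (auto simp: kappa_def)

lemma face_figure_in_image_kappa:
  fixes \<Gamma> :: "('n::finite \<times> 'n) set"
  assumes "G \<in> face_figure (order_polytope \<Gamma>) (face01 \<Gamma>)"
  shows "\<exists>F \<in> faces (braid_cone \<Gamma>). kappa F = G"
proof -
  define m :: "real ^ 'n" where "m = (1/2) *\<^sub>R 1"
  from assms have G: "G face_of order_polytope \<Gamma>" and G0: "0 \<in> G" and G1: "1 \<in> G"
    by (auto simp: face_figure_face01 faces_def)
  have cvx: "convex G" using G by (auto simp: face_of_def)
  have extr: "a \<in> G \<and> b \<in> G"
    if "a \<in> order_polytope \<Gamma>" "b \<in> order_polytope \<Gamma>" "x \<in> G" "x \<in> open_segment a b" for a b x
    using G that by (auto simp: face_of_def)
  have GP: "y \<in> order_polytope \<Gamma>" if "y \<in> G" for y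
    using G that face_of_imp_subset by blast
  have mG: "m \<in> G"
    using convexD[OF cvx G0 G1, of "1/2" "1/2"] by (simp add: m_def)
  have shrink: "m + e' *\<^sub>R x \<in> G" if "m + e *\<^sub>R x \<in> G" "0 < e'" "e' \<le> e" for e e' x
  proof -
    have "(1 - e'/e) *\<^sub>R m + (e'/e) *\<^sub>R (m + e *\<^sub>R x) = m + e' *\<^sub>R x"
      using that by (simp add: algebra_simps)
    then show ?thesis
      using convexD[OF cvx mG that(1), of "1 - e'/e" "e'/e"] that by simp
  qed
  \<comment> \<open>The feasible directions of G at m that lie in the cone: the candidate preimage
    of G.\<close>
  define F where "F = {x \<in> braid_cone \<Gamma>. \<exists>e>0. m + e *\<^sub>R x \<in> G}"
  have half: "m + (1/2) *\<^sub>R x = (1/2) *\<^sub>R 1 + (1/2) *\<^sub>R x" for x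
    by (simp add: m_def)
  have "F face_of braid_cone \<Gamma>"
    unfolding face_of_def
  proof (intro conjI ballI impI)
    show "F \<subseteq> braid_cone \<Gamma>" by (auto simp: F_def)
    show "convex F"
    proof (rule convexI)
      fix x y :: "real ^ 'n" and u v :: real
      assume x: "x \<in> F" and y: "y \<in> F" and uv: "0 \<le> u" "0 \<le> v" "u + v = 1"
      then obtain e e' where e: "0 < e" "0 < e'" "m + e *\<^sub>R x \<in> G" "m + e' *\<^sub>R y \<in> G"
        by (auto simp: F_def)
      \<comment> \<open>With a common step for both directions, convexity of G at that step
        suffices.\<close>
      let ?d = "min e e'"
      have "u *\<^sub>R (m + ?d *\<^sub>R x) + v *\<^sub>R (m + ?d *\<^sub>R y) \<in> G"
        using e uv by (intro convexD[OF cvx] shrink[OF e(3)] shrink[OF e(4)]) auto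
      also have "u *\<^sub>R (m + ?d *\<^sub>R x) + v *\<^sub>R (m + ?d *\<^sub>R y)
          = (u + v) *\<^sub>R m + ?d *\<^sub>R (u *\<^sub>R x + v *\<^sub>R y)"
        by (simp add: algebra_simps)
      finally have "m + ?d *\<^sub>R (u *\<^sub>R x + v *\<^sub>R y) \<in> G" using uv by simp
      moreover have "u *\<^sub>R x + v *\<^sub>R y \<in> braid_cone \<Gamma>"
        using x y uv by (intro convexD[OF convex_braid_cone]) (auto simp: F_def)
      moreover have "0 < ?d" using e by simp
      ultimately show "u *\<^sub>R x + v *\<^sub>R y \<in> F"
        unfolding F_def by blast
    qed
  next
    fix a b x
    assume ab: "a \<in> braid_cone \<Gamma>" "b \<in> braid_cone \<Gamma>" and "x \<in> F" and seg: "x \<in> open_segment a b"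
    then obtain e where e: "0 < e" "m + e *\<^sub>R x \<in> G"
      by (auto simp: F_def)
    obtain da where da: "0 < da" "\<And>e. 0 < e \<Longrightarrow> e \<le> da \<Longrightarrow> m + e *\<^sub>R a \<in> cbox 0 1"
      using centre_plus_small_in_cube[of a] unfolding m_def by blast
    obtain db where db: "0 < db" "\<And>e. 0 < e \<Longrightarrow> e \<le> db \<Longrightarrow> m + e *\<^sub>R b \<in> cbox 0 1"
      using centre_plus_small_in_cube[of b] unfolding m_def by blast
    \<comment> \<open>At most e, so that \<open>shrink\<close> keeps the point over x in G; at most
      da and db, so that the points over a and b stay in the cube.\<close>
    define d where "d = min e (min da db)"
    have d: "0 < d" "d \<le> e" "d \<le> da" "d \<le> db"
      using e da db by (auto simp: d_def)
    have "m + d *\<^sub>R a \<in> order_polytope \<Gamma>" "m + d *\<^sub>R b \<in> order_polytope \<Gamma>"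
      using ab d da(2)[of d] db(2)[of d] braid_cone_affine[of _ \<Gamma> d "1/2"]
      by (auto simp: order_polytope_def m_def)
    moreover have "m + d *\<^sub>R x \<in> G"
      using shrink[OF e(2)] d by blast
    moreover have "m + d *\<^sub>R x \<in> open_segment (m + d *\<^sub>R a) (m + d *\<^sub>R b)"
    proof -
      from seg obtain u where u: "a \<noteq> b" "0 < u" "u < 1" "x = (1 - u) *\<^sub>R a + u *\<^sub>R b"
        by (auto simp: in_segment)
      have "m + d *\<^sub>R x = (1 - u) *\<^sub>R (m + d *\<^sub>R a) + u *\<^sub>R (m + d *\<^sub>R b)"
        unfolding u(4) by (simp add: algebra_simps)
      then show ?thesis using u d by (auto simp: in_segment)
    qed
    ultimately have "m + d *\<^sub>R a \<in> G \<and> m + d *\<^sub>R b \<in> G"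
      by (rule extr)
    then show "a \<in> F" "b \<in> F"
      using ab d by (auto simp: F_def)
  qed
  moreover have GF: "G \<subseteq> F"
  proof
    fix x assume x: "x \<in> G"
    \<comment> \<open>This is the midpoint of 1 and x, so 1/2 is a witness for the step.\<close>
    then have "m + (1/2) *\<^sub>R x \<in> G"
      unfolding half using G1 by (intro convexD[OF cvx]) auto
    moreover have "x \<in> braid_cone \<Gamma>"
      using GP[OF x] by (simp add: order_polytope_def)
    ultimately show "x \<in> F"
      unfolding F_def by (intro CollectI conjI exI[of _ "1/2"]) auto
  qed
  ultimately have Ffaces: "F \<in> faces (braid_cone \<Gamma>)"
    using G0 by (auto simp: faces_def)
  have "x \<in> G" if x: "x \<in> F" "x \<in> cbox 0 1" for x
  \<comment> \<open>For x = 0 the segment from m to m + x/2 degenerates, for x = 1 the one from 1 to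
    x does; both points are in G anyway.\<close>
  proof (cases "x = 0 \<or> x = 1")
    case False
    from x have xP: "x \<in> order_polytope \<Gamma>" by (simp add: F_def order_polytope_def)
    have oP: "1 \<in> order_polytope \<Gamma>" using GP G1 .
    have hP: "m + (1/2) *\<^sub>R x \<in> order_polytope \<Gamma>"
      unfolding half using xP oP by (intro convexD[OF convex_order_polytope]) auto
    obtain e where e: "0 < e" "m + e *\<^sub>R x \<in> G"
      using x by (auto simp: F_def)
    have h: "m + (1/2) *\<^sub>R x \<in> G"
    proof (cases "1/2 \<le> e")
      case True
      then show ?thesis using shrink[OF e(2)] by simp
    next
      \<comment> \<open>Here m + ex lies strictly between m and m + x/2, so the face property
        extends G outward to m + x/2.\<close>
      case small: False
      have "m + e *\<^sub>R x = (1 - 2*e) *\<^sub>R m + (2*e) *\<^sub>R (m + (1/2) *\<^sub>R x)"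
        by (simp add: algebra_simps)
      then have "m + e *\<^sub>R x \<in> open_segment m (m + (1/2) *\<^sub>R x)"
        using small False e(1) by (auto simp: in_segment intro!: exI[of _ "2*e"])
      then show ?thesis using extr[OF GP[OF mG] hP e(2)] by blast
    qed
    \<comment> \<open>A second use of the face property, at the midpoint of 1 and x, leads from m +
      x/2 to x itself.\<close>
    have "m + (1/2) *\<^sub>R x \<in> open_segment 1 x"
      unfolding half using False by (auto simp: in_segment intro!: exI[of _ "1/2"])
    then show ?thesis using extr[OF oP xP h] by blast
  qed (use G0 G1 in auto)
  then have "kappa F = G"
    using GF GP by (auto simp: kappa_def order_polytope_def)
  with Ffaces show ?thesis by blast
qed

theorem lemma10:
  fixes \<Gamma> :: "('n::finite \<times> 'n) set"
  assumes "acyclic \<Gamma>"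
  shows "inclusion_iso kappa (faces (braid_cone \<Gamma>)) (face_figure (order_polytope \<Gamma>) (face01 \<Gamma>))"
  unfolding inclusion_iso_def bij_betw_def
proof (intro conjI ballI)
  show "inj_on kappa (faces (braid_cone \<Gamma>))"
    by (rule inj_onI) (metis kappa_subset_iff order_refl subset_antisym)
  show "kappa ` faces (braid_cone \<Gamma>) = face_figure (order_polytope \<Gamma>) (face01 \<Gamma>)"
    using kappa_in_face_figure face_figure_in_image_kappa by blast
qed (rule kappa_subset_iff[symmetric])

end
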